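(* Let $(\check{\mathfrak g},J,\omega)$ be a pseudo-Kähler nilpotent Lie algebra with metric $\check g$ and with nonzero metric Nikolayevsky derivation, and let $\check D$ be a derivation of $\check{\mathfrak g}$ with $\check D^s=\mathrm{Id}$. If $\mathfrak k=\check{\mathfrak g}\oplus\mathrm{Span}\{b\}$ is the central extension of $\check{\mathfrak g}$ characterized by $db^*=2\omega$, where $\{b^*\}$ is the basis dual to $\{b\}$, with the metric $g=\check g-b^*\otimes b^*$, then the semidirect product $\widetilde{\mathfrak k}=\mathfrak k\rtimes\mathrm{Span}\{e_0\}$, where \[[e_0,x]=\check Dx\ (x\in\check{\mathfrak g}),\qquad [e_0,b]=2b,\] has a pseudo-Kähler-Einstein structure $(\widetilde g,\widetilde J,\widetilde\omega)$ given by \[\widetilde g=g-e^0\otimes e^0,\qquad \widetilde J(w)=J(w)-g(b,w)e_0\ (w\in\mathfrak k),\qquad \widetilde J(e_0)=-b,\] with $\widetilde{\mathrm{ric}}=(2n+2)\widetilde g$, where $2n$ is the dimension of $\widetilde{\mathfrak k}$.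
   Context: Lie algebras are real and finite-dimensional. For a one-form $\alpha$, $d\alpha(X,Y)=-\alpha([X,Y])$. A metric on a Lie algebra is a nondegenerate symmetric bilinear form of any signature; its Ricci tensor is that of the corresponding left-invariant metric on a Lie group; Einstein means $\mathrm{ric}=\lambda g$ for a constant $\lambda$. A pseudo-Kähler structure $(g,J,\omega)$ on a Lie algebra consists of a metric $g$, an endomorphism $J$ with $J^2=-\mathrm{Id}$, vanishing Nijenhuis tensor and $g(JX,JY)=g(X,Y)$, and the two-form $\omega(X,Y)=g(X,JY)$, which is required to be closed; it is pseudo-Kähler-Einstein if $g$ is Einstein. $\check D^s=\frac12(\check D+\check D^* )$, with $\check D^*$ the adjoint with respect to $\check g$. The metric Nikolayevsky derivation of $(\check{\mathfrak g},\check g)$ is a semisimple (diagonalizable over $\mathbb C$) derivation $N$ lying in $\mathfrak{co}=\{A\in\mathfrak{gl}(\check{\mathfrak g}) : A=S+c\,\mathrm{Id},\ S \text{ skew-symmetric for } \check g,\ c\in\mathbb R\}$ with $\mathrm{tr}(N\psi)=\mathrm{tr}\,\psi$ for all $\psi\in\mathfrak{co}\cap\mathrm{Der}\,\check{\mathfrak g}$; it exists and is unique up to automorphisms. In the central extension, $b$ is central and $[x,y]_{\mathfrak k}=[x,y]_{\check{\mathfrak g}}-2\omega(x,y)b$ for $x,y\in\check{\mathfrak g}$; $b^*$ vanishes on $\check{\mathfrak g}$; $\check g$ and $J$ are extended to $\mathfrak k$ by zero on $b$; $e^0(e_0)=1$, $e^0|_{\mathfrak k}=0$; $\widetilde\omega(X,Y)=\widetilde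 g(X,\widetilde JY)$.
   Formalization: It is additionally assumed that x ↦ Ďx, b ↦ 2b is a derivation of 𝔨 (equivalently Ď commutes with J), so that the semidirect product is a Lie algebra; this can fail, e.g. for abelian R⁴ and Ď = Id + A with A skew not commuting with J. *)

theory Defs
  imports "HOL-Analysis.Analysis"
begin

text \<open>
  A finite-dimensional real Lie algebra is a bracket on a type of class
  \<open>euclidean_space\<close>. The inner product of that class is auxiliary: it enters only
  through \<open>Basis\<close>, which computes (basis-independent) traces.
\<close>

section \<open>Lie algebras\<close>

definition lie_algebra :: "('a::euclidean_space \<Rightarrow> 'a \<Rightarrow> 'a) \<Rightarrow> bool" where
  "lie_algebra br \<longleftrightarrow> bilinear br \<and> (\<forall>x. br x x = 0) \<and>
     (\<forall>x y z. br x (br y z) + br y (br z x) + br z (br x y) = 0)"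

primrec lower_central :: "('a::euclidean_space \<Rightarrow> 'a \<Rightarrow> 'a) \<Rightarrow> nat \<Rightarrow> 'a set" where
  "lower_central br 0 = UNIV"
| "lower_central br (Suc k) = span {br x y | x y. y \<in> lower_central br k}"

definition nilpotent_lie :: "('a::euclidean_space \<Rightarrow> 'a \<Rightarrow> 'a) \<Rightarrow> bool" where
  "nilpotent_lie br \<longleftrightarrow> (\<exists>k. lower_central br k = {0})"

definition derivation :: "('a::euclidean_space \<Rightarrow> 'a \<Rightarrow> 'a) \<Rightarrow> ('a \<Rightarrow> 'a) \<Rightarrow> bool" where
  "derivation br D \<longleftrightarrow> linear D \<and> (\<forall>x y. D (br x y) = br (D x) y + br x (D y))"

definition endo_trace :: "('a::euclidean_space \<Rightarrow> 'a) \<Rightarrow> real" where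
  "endo_trace f = (\<Sum>b\<in>Basis. f b \<bullet> b)"

definition ext_deriv1 :: "('a \<Rightarrow> 'a \<Rightarrow> 'a) \<Rightarrow> ('a \<Rightarrow> real) \<Rightarrow> 'a \<Rightarrow> 'a \<Rightarrow> real" where
  "ext_deriv1 br \<alpha> x y = - \<alpha> (br x y)"

definition ext_deriv2 :: "('a \<Rightarrow> 'a \<Rightarrow> 'a) \<Rightarrow> ('a \<Rightarrow> 'a \<Rightarrow> real) \<Rightarrow> 'a \<Rightarrow> 'a \<Rightarrow> 'a \<Rightarrow> real" where
  "ext_deriv2 br \<omega> x y z = - \<omega> (br x y) z + \<omega> (br x z) y - \<omega> (br y z) x"

section \<open>Metrics and curvature\<close>

definition metric_form :: "('a::euclidean_space \<Rightarrow> 'a \<Rightarrow> real) \<Rightarrow> bool" where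
  "metric_form g \<longleftrightarrow> bilinear g \<and> (\<forall>x y. g x y = g y x) \<and> (\<forall>x. (\<forall>y. g x y = 0) \<longrightarrow> x = 0)"

definition levi_civita ::
  "('a::euclidean_space \<Rightarrow> 'a \<Rightarrow> 'a) \<Rightarrow> ('a \<Rightarrow> 'a \<Rightarrow> real) \<Rightarrow> 'a \<Rightarrow> 'a \<Rightarrow> 'a" where
  "levi_civita br g = (THE nab. bilinear nab \<and>
     (\<forall>x y. nab x y - nab y x = br x y) \<and>
     (\<forall>x y z. g (nab x y) z + g y (nab x z) = 0))"

definition curvature ::
  "('a::euclidean_space \<Rightarrow> 'a \<Rightarrow> 'a) \<Rightarrow> ('a \<Rightarrow> 'a \<Rightarrow> real) \<Rightarrow> 'a \<Rightarrow> 'a \<Rightarrow> 'a \<Rightarrow> 'a" where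
  "curvature br g x y z =
     levi_civita br g x (levi_civita br g y z) - levi_civita br g y (levi_civita br g x z)
       - levi_civita br g (br x y) z"

definition ricci ::
  "('a::euclidean_space \<Rightarrow> 'a \<Rightarrow> 'a) \<Rightarrow> ('a \<Rightarrow> 'a \<Rightarrow> real) \<Rightarrow> 'a \<Rightarrow> 'a \<Rightarrow> real" where
  "ricci br g y z = endo_trace (\<lambda>x. curvature br g x y z)"

definition einstein ::
  "('a::euclidean_space \<Rightarrow> 'a \<Rightarrow> 'a) \<Rightarrow> ('a \<Rightarrow> 'a \<Rightarrow> real) \<Rightarrow> bool" where
  "einstein br g \<longleftrightarrow> (\<exists>c. \<forall>x y. ricci br g x y = c * g x y)"

definition metric_adjoint ::
  "('a::euclidean_space \<Rightarrow> 'a \<Rightarrow> real) \<Rightarrow> ('a \<Rightarrow> 'a) \<Rightarrow> 'a \<Rightarrow> 'a" where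
  "metric_adjoint g D = (THE A. \<forall>x y. g (D x) y = g x (A y))"

definition sym_part ::
  "('a::euclidean_space \<Rightarrow> 'a \<Rightarrow> real) \<Rightarrow> ('a \<Rightarrow> 'a) \<Rightarrow> 'a \<Rightarrow> 'a" where
  "sym_part g D x = (1/2) *\<^sub>R (D x + metric_adjoint g D x)"

section \<open>Pseudo-Kaehler structures\<close>

definition nijenhuis ::
  "('a::euclidean_space \<Rightarrow> 'a \<Rightarrow> 'a) \<Rightarrow> ('a \<Rightarrow> 'a) \<Rightarrow> 'a \<Rightarrow> 'a \<Rightarrow> 'a" where
  "nijenhuis br J x y = br (J x) (J y) - J (br (J x) y) - J (br x (J y)) - br x y"

definition pseudo_kaehler ::
  "('a::euclidean_space \<Rightarrow> 'a \<Rightarrow> 'a) \<Rightarrow> ('a \<Rightarrow> 'a \<Rightarrow> real) \<Rightarrow> ('a \<Rightarrow> 'a) \<Rightarrow>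
     ('a \<Rightarrow> 'a \<Rightarrow> real) \<Rightarrow> bool" where
  "pseudo_kaehler br g J \<omega> \<longleftrightarrow>
     metric_form g \<and> linear J \<and> (\<forall>x. J (J x) = - x) \<and>
     (\<forall>x y. nijenhuis br J x y = 0) \<and>
     (\<forall>x y. g (J x) (J y) = g x y) \<and>
     (\<forall>x y. \<omega> x y = g x (J y)) \<and>
     (\<forall>x y z. ext_deriv2 br \<omega> x y z = 0)"

definition pseudo_kaehler_einstein ::
  "('a::euclidean_space \<Rightarrow> 'a \<Rightarrow> 'a) \<Rightarrow> ('a \<Rightarrow> 'a \<Rightarrow> real) \<Rightarrow> ('a \<Rightarrow> 'a) \<Rightarrow>
     ('a \<Rightarrow> 'a \<Rightarrow> real) \<Rightarrow> bool" where
  "pseudo_kaehler_einstein br g J \<omega> \<longleftrightarrow> pseudo_kaehler br g J \<omega> \<and> einstein br g"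

section \<open>The metric Nikolayevsky derivation\<close>

text \<open>
  The complexification of a real space is modelled on pairs, \<open>(u, v)\<close> standing for \<open>u + i v\<close>.
\<close>

definition cscale :: "complex \<Rightarrow> 'a \<times> 'a \<Rightarrow> ('a::real_vector) \<times> 'a" where
  "cscale c w = (Re c *\<^sub>R fst w - Im c *\<^sub>R snd w, Re c *\<^sub>R snd w + Im c *\<^sub>R fst w)"

interpretation complexification: vector_space "cscale :: complex \<Rightarrow> 'a \<times> 'a \<Rightarrow> ('a::real_vector) \<times> 'a"
  by unfold_locales (auto simp: cscale_def algebra_simps prod_eq_iff)

definition complexify :: "('a \<Rightarrow> 'a) \<Rightarrow> 'a \<times> 'a \<Rightarrow> ('a::real_vector) \<times> 'a" where
  "complexify f w = (f (fst w), f (snd w))"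

definition semisimple :: "('a::euclidean_space \<Rightarrow> 'a) \<Rightarrow> bool" where
  "semisimple f \<longleftrightarrow> module.span cscale {w. \<exists>\<mu>. complexify f w = cscale \<mu> w} = UNIV"

definition conformal_endos :: "('a::euclidean_space \<Rightarrow> 'a \<Rightarrow> real) \<Rightarrow> ('a \<Rightarrow> 'a) set" where
  "conformal_endos g = {A. \<exists>S c. linear S \<and> (\<forall>x y. g (S x) y + g x (S y) = 0) \<and>
     (\<forall>x. A x = S x + c *\<^sub>R x)}"

definition metric_nikolayevsky ::
  "('a::euclidean_space \<Rightarrow> 'a \<Rightarrow> 'a) \<Rightarrow> ('a \<Rightarrow> 'a \<Rightarrow> real) \<Rightarrow> ('a \<Rightarrow> 'a) \<Rightarrow> bool" where
  "metric_nikolayevsky br g N \<longleftrightarrow>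
     derivation br N \<and> semisimple N \<and> N \<in> conformal_endos g \<and>
     (\<forall>\<psi>\<in>conformal_endos g. derivation br \<psi> \<longrightarrow> endo_trace (N \<circ> \<psi>) = endo_trace \<psi>)"

section \<open>Extensions\<close>

text \<open>
  Central extension by a one-dimensional space: \<open>(x, t)\<close> stands for \<open>x + t b\<close>, so that
  \<open>b = (0, 1)\<close> and \<open>b\<^sup>* = snd\<close>; it is characterized by \<open>d b\<^sup>* = \<sigma>\<close>.
\<close>

definition central_extension ::
  "('a \<Rightarrow> 'a \<Rightarrow> 'a) \<Rightarrow> ('a \<Rightarrow> 'a \<Rightarrow> real) \<Rightarrow> 'a \<times> real \<Rightarrow> 'a \<times> real \<Rightarrow> 'a \<times> real" where
  "central_extension br \<sigma> v w = (br (fst v) (fst w), - \<sigma> (fst v) (fst w))"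

lemma ext_deriv1_central_extension:
  "ext_deriv1 (central_extension br \<sigma>) snd v w = \<sigma> (fst v) (fst w)"
  by (simp add: ext_deriv1_def central_extension_def)

definition central_b :: "('a::zero) \<times> real" where
  "central_b = (0, 1)"

definition central_metric :: "('a \<Rightarrow> 'a \<Rightarrow> real) \<Rightarrow> 'a \<times> real \<Rightarrow> 'a \<times> real \<Rightarrow> real" where
  "central_metric g v w = g (fst v) (fst w) - snd v * snd w"

definition central_J :: "('a \<Rightarrow> 'a) \<Rightarrow> 'a \<times> real \<Rightarrow> 'a \<times> real" where
  "central_J J v = (J (fst v), 0)"

text \<open>
  The action \<open>x \<mapsto> D x\<close>, \<open>b \<mapsto> 2 b\<close> of \<open>e\<^sub>0\<close> on the central extension. A derivation \<open>D\<close> whose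
  symmetric part is the identity need not make this a derivation of the extension by
  \<open>2 \<omega>\<close>: that also requires \<open>D\<close> to commute with \<open>J\<close>. The semidirect product is a Lie
  algebra only when it is one.
\<close>

definition central_action :: "('a \<Rightarrow> 'a) \<Rightarrow> 'a \<times> real \<Rightarrow> 'a \<times> real" where
  "central_action D v = (D (fst v), 2 * snd v)"

text \<open>
  Semidirect product with a line acting through the derivation \<open>E\<close>: \<open>(v, s)\<close> stands for
  \<open>v + s e\<^sub>0\<close>, so that \<open>e\<^sup>0 = snd\<close> and \<open>[e\<^sub>0, v] = E v\<close>.
\<close>

definition semidirect ::
  "('k::real_vector \<Rightarrow> 'k \<Rightarrow> 'k) \<Rightarrow> ('k \<Rightarrow> 'k) \<Rightarrow> 'k \<times> real \<Rightarrow> 'k \<times> real \<Rightarrow> 'k \<times> real" where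
  "semidirect br E X Y =
     (br (fst X) (fst Y) + snd X *\<^sub>R E (fst Y) - snd Y *\<^sub>R E (fst X), 0)"

definition semidirect_e0 :: "('k::zero) \<times> real" where
  "semidirect_e0 = (0, 1)"

definition tilde_metric ::
  "('a \<Rightarrow> 'a \<Rightarrow> real) \<Rightarrow> ('a \<times> real) \<times> real \<Rightarrow> ('a \<times> real) \<times> real \<Rightarrow> real" where
  "tilde_metric g X Y = central_metric g (fst X) (fst Y) - snd X * snd Y"

text \<open>
  The linear map with \<open>w \<mapsto> J w - g(b, w) e\<^sub>0\<close> on the central extension and \<open>e\<^sub>0 \<mapsto> - b\<close>.
\<close>

definition tilde_J ::
  "('a::real_vector \<Rightarrow> 'a \<Rightarrow> real) \<Rightarrow> ('a \<Rightarrow> 'a) \<Rightarrow> ('a \<times> real) \<times> real \<Rightarrow> ('a \<times> real) \<times> real" where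
  "tilde_J g J X =
     (central_J J (fst X), 0) - central_metric g central_b (fst X) *\<^sub>R semidirect_e0
       + snd X *\<^sub>R (- central_b, 0)"

definition tilde_omega ::
  "('a::real_vector \<Rightarrow> 'a \<Rightarrow> real) \<Rightarrow> ('a \<Rightarrow> 'a) \<Rightarrow>
     ('a \<times> real) \<times> real \<Rightarrow> ('a \<times> real) \<times> real \<Rightarrow> real" where
  "tilde_omega g J X Y = tilde_metric g X (tilde_J g J Y)"

end

theory Submission
  imports Defs
begin

text \<open>
  On a pseudo-Kaehler Lie algebra \<open>J\<close> is parallel, so the Ricci form can be read off from the
  bracket alone: with \<open>h w = tr (J \<circ> ad w) - tr (ad (J w))\<close> one has \<open>2 ric(y, J z) = h [y, z]\<close>
  (\<open>ricci_J_eq\<close>). Hence the Einstein condition amounts to saying that \<open>h\<close> restricted to commutators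
  is a multiple of a potential of the Kaehler form, and no curvature of the extension has to be
  computed.

  The Kaehler form of the extension is exact: it is \<open>d b\<^sup>* / 2\<close>, where \<open>b\<^sup>*\<close> is the coordinate
  along \<open>b\<close> (\<open>tilde_omega_exact\<close>). So it remains to see that \<open>h\<close> is a multiple of \<open>b\<^sup>*\<close> on the
  derived algebra, which lies in the central extension. On the original nilpotent algebra
  \<open>ad z\<close> and \<open>J \<circ> ad z\<close> are both traceless, the second because in the complexification
  the subalgebra of vectors of type \<open>(0,1)\<close> acts nilpotently on the quotient by itself
  (\<open>endo_trace_complex_ad_nilpotent\<close>); therefore \<open>h\<close> vanishes there. Since the complex structure
  sends \<open>b\<close> to \<open>e\<^sub>0\<close>, the value \<open>h b\<close> is \<open>- 2 - tr (ad e\<^sub>0)\<close>, and \<open>ad e\<^sub>0\<close> has trace \<open>tr D + 2\<close>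
  with \<open>tr D = m\<close>, the dimension of the original algebra, because \<open>D\<close> differs from the identity by
  a skew map. With \<open>b\<^sup>*([X, Y]) = - 2 \<omega>(X, Y)\<close> for the Kaehler form \<open>\<omega>\<close> of the extension this
  gives the Einstein constant \<open>m + 4\<close>, that is the dimension of the extension plus two.

  That the structure is pseudo-Kaehler uses one more fact: \<open>D\<close> commutes with \<open>J\<close>, since \<open>e\<^sub>0\<close>
  has to act on the central extension by a derivation while \<open>D\<close> dilates the metric (\<open>D_J\<close>).
\<close>

section \<open>Traces\<close>

lemma endo_trace_add: "endo_trace (\<lambda>x. f x + h x) = endo_trace f + endo_trace h"
  by (simp add: endo_trace_def inner_add_left sum.distrib)

lemma endo_trace_diff: "endo_trace (\<lambda>x. f x - h x) = endo_trace f - endo_trace h"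
  by (simp add: endo_trace_def inner_diff_left sum_subtractf)

lemma endo_trace_uminus: "endo_trace (\<lambda>x. - f x) = - endo_trace f"
  by (simp add: endo_trace_def sum_negf)

lemma endo_trace_scaleR: "endo_trace (\<lambda>x. c *\<^sub>R f x) = c * endo_trace f"
  by (simp add: endo_trace_def sum_distrib_left)

lemma endo_trace_id: "endo_trace (\<lambda>x::'a::euclidean_space. x) = real DIM('a)"
  by (simp add: endo_trace_def)

lemma endo_trace_commute:
  fixes f h :: "'a::euclidean_space \<Rightarrow> 'a"
  assumes "linear f" "linear h"
  shows "endo_trace (\<lambda>x. f (h x)) = endo_trace (\<lambda>x. h (f x))"
proof -
  have expand: "endo_trace (\<lambda>x. p (q x)) = (\<Sum>b\<in>Basis. \<Sum>c\<in>Basis. (q b \<bullet> c) * (p c \<bullet> b))"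
    if "linear p" for p q :: "'a \<Rightarrow> 'a"
  proof -
    have "p (q b) = (\<Sum>c\<in>Basis. (q b \<bullet> c) *\<^sub>R p c)" for b
      using linear_sum[OF that, of "\<lambda>c. (q b \<bullet> c) *\<^sub>R c" Basis] linear_scale[OF that]
      by (simp add: euclidean_representation)
    then show ?thesis
      by (simp add: endo_trace_def inner_sum_left)
  qed
  show ?thesis
    unfolding expand[OF assms(1)] expand[OF assms(2)]
    by (subst sum.swap) (simp add: mult.commute)
qed

lemma endo_trace_adjoint:
  assumes "linear f"
  shows "endo_trace (adjoint f) = endo_trace f"
  by (simp add: endo_trace_def adjoint_clauses[OF assms] inner_commute)

lemma endo_trace_prod:
  fixes f :: "'a::euclidean_space \<times> 'b::euclidean_space \<Rightarrow> 'a \<times> 'b"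
  shows "endo_trace f = endo_trace (\<lambda>x. fst (f (x, 0))) + endo_trace (\<lambda>y. snd (f (0, y)))"
proof -
  have "inj_on (\<lambda>u. (u::'a, 0::'b)) Basis" "inj_on (\<lambda>u. (0::'a, u::'b)) Basis"
    by (auto intro!: inj_onI)
  then show ?thesis
    unfolding endo_trace_def Basis_prod_def
    by (subst sum.union_disjoint) (auto simp: sum.reindex inner_prod_def)
qed

lemma endo_trace_real: "endo_trace (f :: real \<Rightarrow> real) = f 1"
  by (simp add: endo_trace_def)

text \<open>
  Let \<open>P\<^sub>i\<close> be a projection onto the range of \<open>f\<^sup>i\<close>. Cyclicity of the trace gives
  \<open>tr (f P\<^sub>i) = tr (P\<^bsub>i+1\<^esub> f P\<^sub>i) = tr (f P\<^sub>i P\<^bsub>i+1\<^esub>) = tr (f P\<^bsub>i+1\<^esub>)\<close>, so the trace of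
  \<open>f = f P\<^sub>0\<close> is that of \<open>f P\<^sub>k = 0\<close>.
\<close>
lemma endo_trace_nilpotent:
  fixes f :: "'a::euclidean_space \<Rightarrow> 'a"
  assumes lin: "linear f" and nil: "\<And>x. (f ^^ k) x = 0"
  shows "endo_trace f = 0"
proof -
  have linp: "linear (f ^^ i)" for i
    by (induction i) (use linear_compose[OF _ lin] in \<open>auto simp: linear_id[unfolded id_def] id_def o_def\<close>)
  have "\<exists>P. linear P \<and> range P \<subseteq> range (f ^^ i) \<and> (\<forall>v\<in>range (f ^^ i). P v = v)" for i
    using linear_exists_left_inverse_on[OF linear_id, of "range (f ^^ i)"]
      linear_subspace_image[OF linp subspace_UNIV, of i] by (auto simp: inj_on_def)
  then obtain P where P: "\<And>i. linear (P i)" "\<And>i. range (P i) \<subseteq> range (f ^^ i)"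
      "\<And>i v. v \<in> range (f ^^ i) \<Longrightarrow> P i v = v"
    by metis
  have f_in: "f v \<in> range (f ^^ Suc i)" if "v \<in> range (f ^^ i)" for i v
    using that by auto
  have down: "v \<in> range (f ^^ i)" if "v \<in> range (f ^^ Suc i)" for i v
    using that by (auto simp: funpow_swap1)
  have step: "endo_trace (\<lambda>x. f (P i x)) = endo_trace (\<lambda>x. f (P (Suc i) x))" for i
  proof -
    have "endo_trace (\<lambda>x. f (P i x)) = endo_trace (\<lambda>x. P (Suc i) (f (P i x)))"
      using P(2)[of i] by (simp add: P(3)[OF f_in] image_subset_iff)
    also have "\<dots> = endo_trace (\<lambda>x. f (P i (P (Suc i) x)))"
      using endo_trace_commute[OF P(1)[of "Suc i"] linear_compose[OF P(1)[of i] lin]]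
      by (simp add: o_def)
    also have "\<dots> = endo_trace (\<lambda>x. f (P (Suc i) x))"
    proof -
      have "P i (P (Suc i) x) = P (Suc i) x" for x
        using P(2)[of "Suc i"] by (intro P(3)[OF down]) blast
      then show ?thesis by simp
    qed
    finally show ?thesis .
  qed
  have "endo_trace (\<lambda>x. f (P 0 x)) = endo_trace (\<lambda>x. f (P i x))" for i
    by (induction i) (simp_all flip: step)
  from this[of k] have "endo_trace (\<lambda>x. f (P 0 x)) = endo_trace (\<lambda>x. f (P k x))" .
  moreover have "P 0 x = x" for x
    by (intro P(3)) simp
  moreover have "P k x = 0" for x
    using P(2)[of k] nil by auto
  ultimately show ?thesis
    by (simp add: linear_0[OF lin] endo_trace_def)
qed

section \<open>Bilinear maps and nondegenerate forms\<close>

lemmas bilinear_rules = bilinear_ladd bilinear_radd bilinear_lsub bilinear_rsub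
  bilinear_lmul bilinear_rmul bilinear_lneg bilinear_rneg bilinear_lzero bilinear_rzero

lemma bilinear_imp_linear_right: "bilinear h \<Longrightarrow> linear (h x)"
  by (simp add: bilinear_def)

lemma bilinear_imp_linear_left: "bilinear h \<Longrightarrow> linear (\<lambda>x. h x y)"
  by (simp add: bilinear_def)

lemma bilinear_alternating_anti:
  assumes "bilinear h" "\<And>x. h x x = 0"
  shows "h x y = - h y x"
proof -
  have "h (x + y) (x + y) = h x x + h y y + (h x y + h y x)"
    by (simp add: bilinear_rules[OF assms(1)])
  then show ?thesis
    by (simp only: assms(2)) (simp add: eq_neg_iff_add_eq_0)
qed

text \<open>
  The Gram operator reduces statements about \<open>g\<close> to the auxiliary inner product, for which
  transposes exist and have the same trace.
\<close>
lemma metric_form_gram: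
  fixes g :: "'a::euclidean_space \<Rightarrow> 'a \<Rightarrow> real"
  assumes "metric_form g"
  obtains G where "linear G" "bij G" "\<And>x y. G x \<bullet> y = g x y"
proof -
  have bil: "bilinear g" and nondeg: "\<And>x. (\<And>y. g x y = 0) \<Longrightarrow> x = 0"
    using assms by (auto simp: metric_form_def)
  define G where "G x = (\<Sum>b\<in>Basis. g x b *\<^sub>R b)" for x
  have lin: "linear G"
    by (rule linearI)
      (simp_all add: G_def bilinear_rules[OF bil] scaleR_add_left sum.distrib scaleR_sum_right)
  have inner: "G x \<bullet> y = g x y" for x y
  proof -
    have "g x y = (\<Sum>b\<in>Basis. (y \<bullet> b) * g x b)"
      using linear_sum[OF bilinear_imp_linear_right[OF bil], of x "\<lambda>b. (y \<bullet> b) *\<^sub>R b" Basis]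
      by (simp add: bilinear_rules[OF bil] euclidean_representation)
    then show ?thesis
      by (simp add: G_def inner_sum_left inner_commute[of y] mult.commute)
  qed
  have "inj G"
    unfolding linear_injective_0[OF lin] by (metis inner inner_zero_left nondeg)
  then have "bij G"
    using linear_injective_imp_surjective[OF lin] by (simp add: bij_def)
  with lin inner show ?thesis using that by blast
qed

lemma metric_form_riesz:
  fixes g :: "'a::euclidean_space \<Rightarrow> 'a \<Rightarrow> real"
  assumes g: "metric_form g" and f: "linear f"
  obtains w where "\<And>z. g w z = f z"
proof -
  obtain G where G: "linear G" "bij G" "\<And>x y. G x \<bullet> y = g x y"
    using metric_form_gram[OF g] by blast
  obtain w where "G w = adjoint f 1"
    using G(2) by (metis bij_pointE)
  then have "g w z = f z" for z
    by (simp add: G(3)[symmetric] adjoint_clauses[OF f])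
  then show ?thesis using that by blast
qed

lemma metric_form_eqI:
  assumes "metric_form g" "\<And>z. g x z = g y z"
  shows "x = y"
proof -
  have "bilinear g" using assms(1) by (simp add: metric_form_def)
  then have "g (x - y) z = 0" for z
    using assms(2) by (simp add: bilinear_rules)
  then have "x - y = 0"
    using assms(1) unfolding metric_form_def by blast
  then show ?thesis by simp
qed

text \<open>A skew endomorphism is conjugate, by the Gram operator, to minus its transpose.\<close>
lemma endo_trace_skew:
  fixes g :: "'a::euclidean_space \<Rightarrow> 'a \<Rightarrow> real"
  assumes g: "metric_form g" and S: "linear S" and skew: "\<And>x y. g (S x) y + g x (S y) = 0"
  shows "endo_trace S = 0"
proof -
  obtain G where G: "linear G" "bij G" "\<And>x y. G x \<bullet> y = g x y"
    using metric_form_gram[OF g] by blast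
  have inv_lin: "linear (inv G)"
    using G by (simp add: bij_is_inj inj_linear_imp_inv_linear)
  have "G (S x) = - adjoint S (G x)" for x
  proof -
    have "y \<bullet> G (S x) = y \<bullet> - adjoint S (G x)" for y
      using skew[of x y] by (simp add: adjoint_works[OF S] G(3)[symmetric] inner_commute)
    then show ?thesis
      by (metis vector_eq_ldot)
  qed
  then have "S x = inv G (- adjoint S (G x))" for x
    using G(2) by (metis bij_is_inj inv_f_f)
  then have "endo_trace S = endo_trace (\<lambda>x. inv G (- adjoint S (G x)))"
    by (intro arg_cong[where f = endo_trace] ext)
  also have "\<dots> = endo_trace (\<lambda>x. - adjoint S (G (inv G x)))"
    using endo_trace_commute[OF inv_lin, of "\<lambda>x. - adjoint S (G x)"]
      linear_compose_neg[OF linear_compose[OF G(1) adjoint_linear[OF S]]]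
    by (simp add: o_def)
  also have "\<dots> = - endo_trace S"
    using endo_trace_adjoint[OF S]
    by (simp add: bij_is_surj[OF G(2)] surj_f_inv_f endo_trace_uminus)
  finally show ?thesis by simp
qed

section \<open>The Levi-Civita connection\<close>

locale metric_lie_algebra =
  fixes br :: "'a::euclidean_space \<Rightarrow> 'a \<Rightarrow> 'a" and g :: "'a \<Rightarrow> 'a \<Rightarrow> real"
  assumes lie: "lie_algebra br" and metric: "metric_form g"
begin

lemma br_bilinear: "bilinear br"
  using lie by (simp add: lie_algebra_def)

lemma g_bilinear: "bilinear g"
  using metric by (simp add: metric_form_def)

lemmas br_rules = bilinear_rules[OF br_bilinear]
lemmas g_rules = bilinear_rules[OF g_bilinear]

lemma g_sym: "g x y = g y x"
  using metric by (simp add: metric_form_def)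

lemma br_anti: "br x y = - br y x"
  by (rule bilinear_alternating_anti[OF br_bilinear]) (use lie in \<open>simp add: lie_algebra_def\<close>)

lemma jacobi: "br x (br y z) + br y (br z x) + br z (br x y) = 0"
  using lie by (simp add: lie_algebra_def)

lemmas g_eqI = metric_form_eqI[OF metric]

definition is_levi_civita :: "('a \<Rightarrow> 'a \<Rightarrow> 'a) \<Rightarrow> bool" where
  "is_levi_civita nab \<longleftrightarrow> bilinear nab \<and>
     (\<forall>x y. nab x y - nab y x = br x y) \<and>
     (\<forall>x y z. g (nab x y) z + g y (nab x z) = 0)"

definition koszul :: "'a \<Rightarrow> 'a \<Rightarrow> 'a \<Rightarrow> real" where
  "koszul x y z = (g (br x y) z - g (br y z) x + g (br z x) y) / 2"

text \<open>
  Expressing the three brackets through the connection, four of the six resulting terms cancel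
  in pairs because \<open>g(\<nabla>\<^sub>x y, z)\<close> is skew in \<open>y\<close> and \<open>z\<close>.
\<close>
lemma is_levi_civita_koszul:
  assumes "is_levi_civita nab"
  shows "g (nab x y) z = koszul x y z"
proof -
  have br: "g (br u v) w = g (nab u v) w - g (nab v u) w" for u v w
  proof -
    have "br u v = nab u v - nab v u"
      using assms by (simp add: is_levi_civita_def)
    then show ?thesis by (simp add: g_rules)
  qed
  have sk: "g (nab u v) w = - g (nab u w) v" for u v w
  proof -
    have "g (nab u v) w + g v (nab u w) = 0"
      using assms by (simp add: is_levi_civita_def)
    then show ?thesis using g_sym[of v "nab u w"] by simp
  qed
  show ?thesis
    unfolding koszul_def br using sk[of x z y] sk[of y z x] sk[of z y x]
    by (simp add: field_simps)
qed

lemma is_levi_civita_exists: "\<exists>nab. is_levi_civita nab"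
proof -
  have "\<exists>w. \<forall>z. g w z = koszul x y z" for x y
  proof -
    have "linear (koszul x y)"
      by (rule linearI) (simp_all add: koszul_def g_rules br_rules field_simps)
    then show ?thesis
      using metric_form_riesz[OF metric] by metis
  qed
  then obtain nab where nab: "\<And>x y z. g (nab x y) z = koszul x y z"
    by metis
  have "bilinear nab"
    unfolding bilinear_def
    by (auto intro!: linearI g_eqI simp: nab g_rules koszul_def br_rules field_simps)
  moreover have "nab x y - nab y x = br x y" for x y
  proof (rule g_eqI)
    show "g (nab x y - nab y x) z = g (br x y) z" for z
      using br_anti[of x y] br_anti[of y z] br_anti[of z x]
      by (simp add: g_rules nab koszul_def field_simps)
  qed
  moreover have "g (nab x y) z + g y (nab x z) = 0" for x y z
    using br_anti[of x y] br_anti[of y z] br_anti[of z x]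
    by (simp add: g_sym[of y "nab x z"] nab koszul_def g_rules field_simps)
  ultimately show ?thesis
    unfolding is_levi_civita_def by blast
qed

abbreviation nabla :: "'a \<Rightarrow> 'a \<Rightarrow> 'a" where
  "nabla \<equiv> levi_civita br g"

lemma is_levi_civita_nabla: "is_levi_civita nabla"
proof -
  have "\<exists>!nab. is_levi_civita nab"
  proof (rule ex_ex1I[OF is_levi_civita_exists], intro ext g_eqI)
    fix nab nab' x y z
    assume "is_levi_civita nab" "is_levi_civita nab'"
    then show "g (nab x y) z = g (nab' x y) z"
      by (simp add: is_levi_civita_koszul)
  qed
  then show ?thesis
    unfolding levi_civita_def is_levi_civita_def by (rule theI')
qed

lemma nabla_bilinear: "bilinear nabla"
  using is_levi_civita_nabla by (simp add: is_levi_civita_def)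

lemmas nabla_rules = bilinear_rules[OF nabla_bilinear]

lemma nabla_torsion_free: "br x y = nabla x y - nabla y x"
  using is_levi_civita_nabla by (simp add: is_levi_civita_def)

lemma nabla_skew: "g (nabla x y) z + g y (nabla x z) = 0"
  using is_levi_civita_nabla by (simp add: is_levi_civita_def)

lemma endo_trace_nabla: "endo_trace (nabla x) = 0"
  using endo_trace_skew[OF metric, of "nabla x"] nabla_skew
    bilinear_imp_linear_right[OF nabla_bilinear] by blast

section \<open>Symmetries of the curvature\<close>

abbreviation curv :: "'a \<Rightarrow> 'a \<Rightarrow> 'a \<Rightarrow> 'a" where
  "curv \<equiv> curvature br g"

lemma curvature_anti: "curv x y z = - curv y x z"
  using br_anti[of x y] by (simp add: curvature_def nabla_rules)

lemma curvature_linear: "linear (curv x y)"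
proof (rule linearI)
  show "curv x y (u + v) = curv x y u + curv x y v" for u v
    by (simp add: curvature_def nabla_rules)
  show "curv x y (c *\<^sub>R u) = c *\<^sub>R curv x y u" for c u
    by (simp add: curvature_def nabla_rules scaleR_diff_right)
qed

lemma curvature_linear_left: "linear (\<lambda>x. curv x y z)"
proof (rule linearI)
  show "curv (u + v) y z = curv u y z + curv v y z" for u v
    by (simp add: curvature_def nabla_rules br_rules)
  show "curv (c *\<^sub>R u) y z = c *\<^sub>R curv u y z" for c u
    by (simp add: curvature_def nabla_rules br_rules scaleR_diff_right)
qed

lemma curvature_bianchi: "curv x y z + curv y z x + curv z x y = 0"
proof -
  have "curv x y z + curv y z x + curv z x y
    = - (br (br x y) z + br (br y z) x + br (br z x) y)"
    by (simp add: curvature_def nabla_torsion_free[of "br x y" z]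
        nabla_torsion_free[of "br y z" x] nabla_torsion_free[of "br z x" y])
      (simp add: nabla_torsion_free nabla_rules algebra_simps)
  also have "\<dots> = 0"
    using jacobi[of x y z] br_anti[of "br x y" z] br_anti[of "br y z" x] br_anti[of "br z x" y]
    by (simp add: algebra_simps)
  finally show ?thesis .
qed

lemma curvature_skew: "g (curv x y z) w + g z (curv x y w) = 0"
proof -
  have sk: "g (nabla u v) t = - g v (nabla u t)" for u v t
    using nabla_skew[of u v t] by simp
  show ?thesis
    by (simp add: curvature_def g_rules sk)
qed

text \<open>
  The usual octahedron argument: four instances of the Bianchi identity, reduced by skewness in
  the first and in the last pair of arguments, combine to the claim.
\<close>
lemma curvature_pair_symmetry: "g (curv x y z) w = g (curv z w x) y"
proof -
  define F where "F x y z w = g (curv x y z) w" for x y z w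
  have 1: "F x y z w = - F y x z w" for x y z w
    using curvature_anti[of x y z] by (simp add: F_def g_rules)
  have 2: "F x y z w = - F x y w z" for x y z w
    using curvature_skew[of x y z w] g_sym[of z] by (simp add: F_def)
  have 3: "F x y z w + F y z x w + F z x y w = 0" for x y z w
    using curvature_bianchi[of x y z] by (simp add: F_def g_rules(9) flip: g_rules(1))
  have "F x y z w + F y z x w - F x z y w = 0"
    using 3[of x y z w] 1[of z x y w] by simp
  moreover have "- F y z x w - F z w x y + F y w x z = 0"
    using 3[of y z w x] 2[of y z w x] 2[of z w y x] 1[of w y z x] 2[of y w z x] by simp
  moreover have "F z w x y + F x w y z - F x z y w = 0"
    using 3[of z w x y] 1[of w x z y] 2[of x w z y] 2[of x z w y] by simp
  moreover have "- F x w y z - F x y z w + F y w x z = 0"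
    using 3[of w x y z] 1[of w x y z] 2[of x y w z] by simp
  ultimately have "F x y z w = F z w x y" by linarith
  then show ?thesis by (simp add: F_def)
qed

text \<open>
  The curvature operators are skew, hence traceless; the Bianchi identity turns their trace into
  the skew part of the Ricci tensor.
\<close>
lemma ricci_sym: "ricci br g y z = ricci br g z y"
proof -
  have "0 = endo_trace (curv y z)"
    using endo_trace_skew[OF metric, of "curv y z"] curvature_linear curvature_skew by metis
  also have "\<dots> = endo_trace (\<lambda>x. curv x z y - curv x y z)"
  proof -
    have "curv y z x = curv x z y - curv x y z" for x
      using curvature_bianchi[of x y z] unfolding curvature_anti[of z x y]
      by (simp add: algebra_simps)
    then show ?thesis by (intro arg_cong[where f = endo_trace] ext)
  qed
  also have "\<dots> = ricci br g z y - ricci br g y z"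
    by (simp add: endo_trace_diff ricci_def)
  finally show ?thesis by simp
qed

end

section \<open>The Ricci form of a pseudo-Kaehler Lie algebra\<close>

locale pseudo_kaehler_lie_algebra = metric_lie_algebra br g
  for br :: "'a::euclidean_space \<Rightarrow> 'a \<Rightarrow> 'a" and g :: "'a \<Rightarrow> 'a \<Rightarrow> real" +
  fixes J :: "'a \<Rightarrow> 'a" and \<omega> :: "'a \<Rightarrow> 'a \<Rightarrow> real"
  assumes pk: "pseudo_kaehler br g J \<omega>"
begin

lemma J_linear: "linear J"
  using pk by (simp add: pseudo_kaehler_def)

lemmas J_rules = linear_add[OF J_linear] linear_diff[OF J_linear] linear_neg[OF J_linear]
  linear_scale[OF J_linear] linear_0[OF J_linear]

lemma J_J [simp]: "J (J x) = - x"
  using pk by (simp add: pseudo_kaehler_def)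

lemma g_J_J: "g (J x) (J y) = g x y"
  using pk by (simp add: pseudo_kaehler_def)

lemma g_J_skew: "g (J x) y = - g x (J y)"
  using g_J_J[of x "J y"] by (simp add: g_rules)

lemma omega_eq: "\<omega> x y = g x (J y)"
  using pk by (simp add: pseudo_kaehler_def)

lemma nijenhuis_zero: "br (J x) (J y) - J (br (J x) y) - J (br x (J y)) - br x y = 0"
  using pk by (simp add: pseudo_kaehler_def nijenhuis_def)

lemma omega_closed: "- g (br x y) (J z) + g (br x z) (J y) - g (br y z) (J x) = 0"
  using pk by (simp add: pseudo_kaehler_def ext_deriv2_def omega_eq)

text \<open>
  The integrability of \<open>J\<close> and the closedness of \<open>\<omega>\<close> are both linear conditions on the tensor
  \<open>B(x, y, z) = g((\<nabla>\<^sub>x J) y, z)\<close>, which is skew in \<open>y, z\<close> and lets \<open>J\<close> pass from \<open>y\<close> to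
  \<open>z\<close>. The difference of the closedness conditions at \<open>(x, y, z)\<close> and \<open>(x, J y, J z)\<close>,
  corrected by the integrability condition for \<open>y, z\<close> paired with \<open>J x\<close>, is \<open>2 B(x, y, z) = 0\<close>.
\<close>
lemma nabla_J: "nabla x (J y) = J (nabla x y)"
proof -
  define B where "B x y z = g (nabla x (J y) - J (nabla x y)) z" for x y z
  have sk: "g (nabla u v) t = - g v (nabla u t)" for u v t
    using nabla_skew[of u v t] by simp
  have skew: "B x y z = - B x z y" for x y z
    by (simp add: B_def g_rules sk g_J_skew g_sym[of z]  g_sym[of "J z"])
  have J_move: "B x (J y) z = B x y (J z)" for x y z
    by (simp add: B_def g_rules g_J_skew g_J_J nabla_rules)
  have J_J3: "B x y (J (J z)) = - B x y z" for x y z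
    by (simp add: B_def g_rules)
  have cyclic: "B x y z + B y z x + B z x y = 0" for x y z
  proof -
    have B_eq: "B u v t = g (nabla u (J v)) t + g (nabla u v) (J t)" for u v t
      by (simp add: B_def g_rules g_J_skew)
    have move: "g (nabla u (J v)) t = - g (nabla u t) (J v)" for u v t
      using sk[of u "J v" t] g_sym[of "J v"] by simp
    show ?thesis
      using omega_closed[of x y z] unfolding B_eq move
      by (simp add: nabla_torsion_free g_rules)
  qed
  have nij: "B (J x) y z - B (J y) x z + B x y (J z) - B y x (J z) = 0" for x y z
  proof -
    have "B (J x) y z - B (J y) x z + B x y (J z) - B y x (J z)
      = g (br (J x) (J y) - J (br (J x) y) - J (br x (J y)) - br x y) z"
      by (simp add: B_def nabla_torsion_free g_rules g_J_skew g_J_J J_rules)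
    then show ?thesis by (simp add: nijenhuis_zero g_rules)
  qed
  have "B x y z = 0" for x y z
  proof -
    have "B (J y) z (J x) = B (J y) (J z) x" "B (J z) y (J x) = B (J z) (J y) x"
      by (simp_all add: J_move)
    then show ?thesis
      using cyclic[of x y z] cyclic[of x "J y" "J z"] nij[of y z "J x"]
        skew[of "J z" x "J y"] skew[of z x y] J_move[of x y "J z"] J_J3[of x y z]
        J_J3[of y z x] J_J3[of z y x] by simp
  qed
  then show ?thesis
    by (intro g_eqI) (simp add: B_def g_rules)
qed

lemma curvature_J: "curv x y (J z) = J (curv x y z)"
  by (simp add: curvature_def nabla_J J_rules)

text \<open>
  Pair symmetry moves the two \<open>J\<close> from the first pair of arguments to the second, where the
  curvature is complex linear.
\<close>
lemma curvature_J_J: "curv (J x) (J y) z = curv x y z"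
proof (rule g_eqI)
  fix w
  have "g (curv (J x) (J y) z) w = g (J (curv z w x)) (J y)"
    using curvature_pair_symmetry[of "J x" "J y" z w] by (simp add: curvature_J)
  also have "\<dots> = g (curv x y z) w"
    using curvature_pair_symmetry[of x y z w] by (simp add: g_J_J)
  finally show "g (curv (J x) (J y) z) w = g (curv x y z) w" .
qed

text \<open>
  As \<open>R(x, J y) = - R(J x, y)\<close>, one \<open>J\<close> is composed with the operator on each side, and by cyclicity
  of the trace the two meet as \<open>J\<^sup>2 = - 1\<close>.
\<close>
lemma ricci_J_J: "ricci br g (J y) (J z) = ricci br g y z"
proof -
  have "curv x (J y) (J z) = - J (curv (J x) y z)" for x
  proof -
    have "curv x (J y) (J z) = J (curv (- J (J x)) (J y) z)"
      by (simp add: curvature_J)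
    also have "\<dots> = - J (curv (J x) y z)"
      by (simp only: linear_neg[OF curvature_linear_left] curvature_J_J J_rules)
    finally show ?thesis .
  qed
  then have "ricci br g (J y) (J z) = - endo_trace (\<lambda>x. J (curv (J x) y z))"
    by (simp add: ricci_def endo_trace_uminus)
  also have "\<dots> = - endo_trace (\<lambda>x. curv (J (J x)) y z)"
    using endo_trace_commute[OF J_linear linear_compose[OF J_linear curvature_linear_left]]
    by (simp add: o_def)
  also have "\<dots> = ricci br g y z"
    by (simp add: linear_neg[OF curvature_linear_left] endo_trace_uminus ricci_def)
  finally show ?thesis .
qed

text \<open>
  By the Bianchi identity the left-hand side is the difference of two Ricci terms, which are
  opposite to each other because the Ricci tensor is symmetric and invariant under \<open>J\<close>.
\<close>
lemma endo_trace_J_curvature: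
  "endo_trace (\<lambda>x. J (curv y z x)) = - 2 * ricci br g y (J z)"
proof -
  have "J (curv y z x) = curv x z (J y) - curv x y (J z)" for x
  proof -
    have "curv y z x = curv x z y - curv x y z"
      using curvature_bianchi[of x y z] unfolding curvature_anti[of z x y]
      by (simp add: algebra_simps)
    then show ?thesis by (simp add: J_rules curvature_J)
  qed
  then have "endo_trace (\<lambda>x. J (curv y z x)) = ricci br g z (J y) - ricci br g y (J z)"
    by (simp add: endo_trace_diff ricci_def)
  moreover have "ricci br g z (J y) = - ricci br g y (J z)"
  proof -
    have lin: "linear (ricci br g u)" for u
    proof (rule linearI)
      show "ricci br g u (v + w) = ricci br g u v + ricci br g u w" for v w
        by (simp add: ricci_def linear_add[OF curvature_linear] endo_trace_add)
      show "ricci br g u (c *\<^sub>R v) = c *\<^sub>R ricci br g u v" for c v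
        by (simp add: ricci_def linear_scale[OF curvature_linear] endo_trace_scaleR)
    qed
    have "ricci br g z (J y) = ricci br g (J z) (J (J y))"
      by (simp only: ricci_J_J)
    also have "\<dots> = - ricci br g y (J z)"
      by (simp add: linear_neg[OF lin] ricci_sym[of "J z" y])
    finally show ?thesis .
  qed
  ultimately show ?thesis by simp
qed

text \<open>
  As \<open>J\<close> commutes with all \<open>\<nabla>\<^sub>u\<close>, the commutator part of the curvature does not contribute to
  \<open>tr (J \<circ> R(y, z))\<close>, which becomes \<open>- tr (J \<circ> \<nabla>\<^sub>w)\<close> with \<open>w = [y, z]\<close>. Vanishing torsion, used
  twice, replaces \<open>J \<circ> \<nabla>\<^sub>w\<close> by \<open>J \<circ> ad w - ad (J w)\<close> up to the traceless operator \<open>\<nabla>\<^bsub>J w\<^esub>\<close>.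
\<close>
lemma ricci_J_eq:
  "2 * ricci br g y (J z)
    = endo_trace (\<lambda>x. J (br (br y z) x)) - endo_trace (br (J (br y z)))"
proof -
  define w where "w = br y z"
  have nlin: "linear (nabla u)" for u
    by (rule bilinear_imp_linear_right[OF nabla_bilinear])
  have "J (curv y z x) = J (nabla y (nabla z x)) - J (nabla z (nabla y x)) - J (nabla w x)" for x
    by (simp add: curvature_def J_rules w_def)
  then have "endo_trace (\<lambda>x. J (curv y z x)) = endo_trace (\<lambda>x. J (nabla y (nabla z x)))
      - endo_trace (\<lambda>x. J (nabla z (nabla y x))) - endo_trace (\<lambda>x. J (nabla w x))"
    by (simp add: endo_trace_diff)
  also have "endo_trace (\<lambda>x. J (nabla y (nabla z x))) = endo_trace (\<lambda>x. J (nabla z (nabla y x)))"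
    using endo_trace_commute[OF nlin[of y] linear_compose[OF nlin[of z] J_linear]]
    by (simp add: nabla_J o_def)
  also have "endo_trace (\<lambda>x. J (nabla w x))
      = endo_trace (\<lambda>x. J (br w x)) - endo_trace (br (J w))"
  proof -
    have "J (nabla w x) = J (br w x) - br (J w) x + nabla (J w) x" for x
      by (simp add: nabla_torsion_free J_rules nabla_J)
    then have "endo_trace (\<lambda>x. J (nabla w x))
      = endo_trace (\<lambda>x. J (br w x)) - endo_trace (\<lambda>x. br (J w) x) + endo_trace (\<lambda>x. nabla (J w) x)"
      by (simp add: endo_trace_diff endo_trace_add)
    then show ?thesis by (simp add: endo_trace_nabla)
  qed
  finally show ?thesis
    by (simp add: endo_trace_J_curvature w_def)
qed

end

section \<open>Traces on nilpotent Lie algebras\<close>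

lemma endo_trace_ad_nilpotent:
  assumes br: "bilinear br" and nil: "nilpotent_lie br"
  shows "endo_trace (br x) = 0"
proof -
  obtain k where k: "lower_central br k = {0}"
    using nil by (auto simp: nilpotent_lie_def)
  have "(br x ^^ i) y \<in> lower_central br i" for i y
    by (induction i) (auto intro!: span_base)
  from this[of k] have "(br x ^^ k) y = 0" for y
    using k by blast
  then show ?thesis
    by (rule endo_trace_nilpotent[OF bilinear_imp_linear_right[OF br]])
qed

text \<open>
  Integrability makes the vectors \<open>x + i J x\<close> a subalgebra of the complexification, so they act on
  the quotient by this subalgebra. That quotient is the original space with complex structure
  \<open>J\<close>, the projection being \<open>u + i v \<mapsto> u + J v\<close>, and \<open>x + i J x\<close> acts on it as
  \<open>L x = ad x + J \<circ> ad (J x)\<close>. Being induced by a nilpotent operator \<open>L x\<close> is nilpotent, and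
  \<open>tr (ad x) = 0\<close> leaves \<open>tr (J \<circ> ad (J x)) = 0\<close>.
\<close>
lemma endo_trace_complex_ad_nilpotent:
  assumes br: "bilinear br" and nil: "nilpotent_lie br"
    and J: "linear J" "\<And>x. J (J x) = - x" and nij: "\<And>x y. nijenhuis br J x y = 0"
  shows "endo_trace (\<lambda>y. J (br x y)) = 0"
proof -
  note rules = bilinear_rules[OF br] linear_add[OF J(1)] linear_diff[OF J(1)]
    linear_neg[OF J(1)] linear_scale[OF J(1)] linear_0[OF J(1)]
  define L where "L x y = br x y + J (br (J x) y)" for x y
  have L_lin: "linear (L u)" for u
    by (rule linearI) (simp_all add: L_def rules algebra_simps)
  have L_J: "L u (J v) = J (L u v)" for u v
  proof -
    have "br (J u) (J v) = J (br (J u) v) + J (br u (J v)) + br u v"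
      using nij[of u v] by (simp add: nijenhuis_def algebra_simps)
    then show ?thesis by (simp add: L_def rules J(2))
  qed
  obtain k where k: "lower_central br k = {0}"
    using nil by (auto simp: nilpotent_lie_def)
  have flag: "\<exists>p\<in>lower_central br i. \<exists>q\<in>lower_central br i. (L u ^^ i) v = p + J q" for u v i
  proof (induction i)
    case 0
    have "v = v + J 0" by (simp add: rules)
    then show ?case by (metis UNIV_I funpow_0 lower_central.simps(1))
  next
    case (Suc i)
    then obtain p q where pq: "p \<in> lower_central br i" "q \<in> lower_central br i"
        "(L u ^^ i) v = p + J q" by blast
    have "(L u ^^ Suc i) v = (br u p - br (J u) q) + J (br (J u) p + br u q)"
      by (simp add: pq(3) linear_add[OF L_lin] L_J) (simp add: L_def rules J(2))
    moreover have "br u p - br (J u) q \<in> lower_central br (Suc i)"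
        "br (J u) p + br u q \<in> lower_central br (Suc i)"
    proof -
      have br_in: "br w r \<in> lower_central br (Suc i)" if "r \<in> lower_central br i" for w r
        using that by (auto intro!: span_base)
      have sub: "subspace (lower_central br (Suc i))"
        by simp
      show "br u p - br (J u) q \<in> lower_central br (Suc i)"
        by (rule subspace_diff[OF sub br_in[OF pq(1)] br_in[OF pq(2)]])
      show "br (J u) p + br u q \<in> lower_central br (Suc i)"
        by (rule subspace_add[OF sub br_in[OF pq(1)] br_in[OF pq(2)]])
    qed
    ultimately show ?case by blast
  qed
  have "endo_trace (L u) = 0" for u
  proof (rule endo_trace_nilpotent[OF L_lin])
    show "(L u ^^ k) v = 0" for v
      using flag[of k u v] k by (auto simp: rules)
  qed
  then have "endo_trace (\<lambda>y. br u y + J (br (J u) y)) = 0" for u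
    by (simp add: L_def[abs_def])
  then have "endo_trace (\<lambda>y. br u y) + endo_trace (\<lambda>y. J (br (J u) y)) = 0" for u
    by (simp only: endo_trace_add)
  then have "endo_trace (\<lambda>y. J (br (J u) y)) = 0" for u
    by (simp add: endo_trace_ad_nilpotent[OF br nil])
  from this[of "- J x"] show ?thesis
    by (simp add: linear_neg[OF J(1)] J(2))
qed

section \<open>Central extensions and semidirect products\<close>

lemma lie_algebra_central_extension:
  assumes lie: "lie_algebra br" and \<sigma>: "bilinear \<sigma>" and alt: "\<And>x. \<sigma> x x = 0"
    and closed: "\<And>x y z. ext_deriv2 br \<sigma> x y z = 0"
  shows "lie_algebra (central_extension br \<sigma>)"
proof -
  have br: "bilinear br" "\<And>x. br x x = 0"
      "\<And>x y z. br x (br y z) + br y (br z x) + br z (br x y) = 0"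
    using lie by (auto simp: lie_algebra_def)
  have anti: "\<sigma> x y = - \<sigma> y x" for x y
    by (rule bilinear_alternating_anti[OF \<sigma> alt])
  have br_anti: "br x y = - br y x" for x y
    by (rule bilinear_alternating_anti[OF br(1,2)])
  have "- \<sigma> x (br y z) - \<sigma> y (br z x) = \<sigma> z (br x y)" for x y z
    using closed[of x y z] anti[of x "br y z"] anti[of z "br x y"] anti[of y "br z x"]
      br_anti[of z x]
    by (simp add: ext_deriv2_def bilinear_rules[OF \<sigma>])
  moreover have "bilinear (central_extension br \<sigma>)"
    unfolding bilinear_def
    by (auto intro!: linearI
        simp: central_extension_def bilinear_rules[OF br(1)] bilinear_rules[OF \<sigma>])
  ultimately show ?thesis
    by (auto simp: lie_algebra_def central_extension_def br alt zero_prod_def)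
qed

lemma lie_algebra_semidirect:
  fixes br :: "'k::euclidean_space \<Rightarrow> 'k \<Rightarrow> 'k"
  assumes lie: "lie_algebra br" and E: "derivation br E"
  shows "lie_algebra (semidirect br E)"
proof -
  have br: "bilinear br" "\<And>x. br x x = 0"
      "\<And>x y z. br x (br y z) + br y (br z x) + br z (br x y) = 0"
    using lie by (auto simp: lie_algebra_def)
  have br_anti: "br x y = - br y x" for x y
    by (rule bilinear_alternating_anti[OF br(1,2)])
  have E_lin: "linear E" and E_br: "\<And>x y. E (br x y) = br (E x) y + br x (E y)"
    using E by (auto simp: derivation_def)
  note rules = bilinear_rules[OF br(1)] linear_add[OF E_lin] linear_diff[OF E_lin]
    linear_neg[OF E_lin] linear_scale[OF E_lin] linear_0[OF E_lin]
  have "bilinear (semidirect br E)"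
    unfolding bilinear_def
    by (auto intro!: linearI simp: semidirect_def rules algebra_simps)
  moreover have "semidirect br E x x = 0" for x
    by (simp add: semidirect_def br(2) zero_prod_def)
  moreover have "semidirect br E x (semidirect br E y z) + semidirect br E y (semidirect br E z x)
      + semidirect br E z (semidirect br E x y) = 0" for x y z
  proof -
    obtain u a v b w c where xyz: "x = (u, a)" "y = (v, b)" "z = (w, c)"
      by (metis prod.exhaust)
    have "br u (br v w) + (br v (br w u) + br w (br u v)) = 0"
      using br(3)[of u v w] by (simp add: add.assoc)
    then show ?thesis
      unfolding xyz using br_anti[of "E u" v] br_anti[of "E v" w] br_anti[of "E w" u]
        br_anti[of "E v" u] br_anti[of "E w" v] br_anti[of "E u" w]
      by (simp add: semidirect_def rules E_br zero_prod_def algebra_simps)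
  qed
  ultimately show ?thesis
    by (simp add: lie_algebra_def)
qed

section \<open>The extension by a homothetic derivation\<close>

lemma metric_adjoint_eq:
  fixes g :: "'a::euclidean_space \<Rightarrow> 'a \<Rightarrow> real"
  assumes g: "metric_form g" and D: "linear D"
  shows "g (D x) y = g x (metric_adjoint g D y)"
proof -
  have bil: "bilinear g" and sym: "\<And>x y. g x y = g y x"
    using g by (auto simp: metric_form_def)
  have "\<exists>w. \<forall>x. g w x = g (D x) y" for y
  proof -
    have "linear (\<lambda>x. g (D x) y)"
      using linear_compose[OF D bilinear_imp_linear_left[OF bil]] by (simp add: o_def)
    then show ?thesis using metric_form_riesz[OF g] by metis
  qed
  then obtain A where A: "\<And>x y. g (A y) x = g (D x) y"
    by metis
  have "\<exists>!A. \<forall>x y. g (D x) y = g x (A y)"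
  proof (rule ex1I[of _ A])
    show "\<forall>x y. g (D x) y = g x (A y)"
      using A sym by metis
    show "A' = A" if "\<forall>x y. g (D x) y = g x (A' y)" for A'
      using that A sym by (intro ext metric_form_eqI[OF g]) metis
  qed
  then have "\<forall>x y. g (D x) y = g x (metric_adjoint g D y)"
    unfolding metric_adjoint_def by (rule theI')
  then show ?thesis by blast
qed

text \<open>
  The automorphisms generated by a derivation with symmetric part the identity are homotheties
  of the metric.
\<close>
locale kaehler_homothety = pseudo_kaehler_lie_algebra br g J \<omega>
  for br :: "'a::euclidean_space \<Rightarrow> 'a \<Rightarrow> 'a" and g :: "'a \<Rightarrow> 'a \<Rightarrow> real"
    and J :: "'a \<Rightarrow> 'a" and \<omega> :: "'a \<Rightarrow> 'a \<Rightarrow> real" +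
  fixes D :: "'a \<Rightarrow> 'a"
  assumes nil: "nilpotent_lie br"
    and D_derivation: "derivation br D"
    and D_sym: "sym_part g D = id"
    and action_derivation:
      "derivation (central_extension br (\<lambda>x y. 2 * \<omega> x y)) (central_action D)"
begin

abbreviation brk :: "'a \<times> real \<Rightarrow> 'a \<times> real \<Rightarrow> 'a \<times> real" where
  "brk \<equiv> central_extension br (\<lambda>x y. 2 * \<omega> x y)"

abbreviation brt :: "('a \<times> real) \<times> real \<Rightarrow> ('a \<times> real) \<times> real \<Rightarrow> ('a \<times> real) \<times> real" where
  "brt \<equiv> semidirect brk (central_action D)"

lemma D_linear: "linear D"
  using D_derivation by (simp add: derivation_def)

lemmas D_rules = linear_add[OF D_linear] linear_diff[OF D_linear] linear_neg[OF D_linear]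
  linear_scale[OF D_linear] linear_0[OF D_linear]

lemma D_metric: "g (D x) y + g x (D y) = 2 * g x y"
proof -
  have "D y + metric_adjoint g D y = 2 *\<^sub>R y"
  proof -
    have "(1/2) *\<^sub>R (D y + metric_adjoint g D y) = y"
      using fun_cong[OF D_sym, of y] by (simp add: sym_part_def)
    then have "2 *\<^sub>R ((1/2) *\<^sub>R (D y + metric_adjoint g D y)) = 2 *\<^sub>R y"
      by simp
    then show ?thesis by simp
  qed
  then have "g x (D y) + g x (metric_adjoint g D y) = 2 * g x y"
    by (simp add: g_rules flip: g_rules(2))
  then show ?thesis
    by (simp add: metric_adjoint_eq[OF metric D_linear])
qed

lemma endo_trace_D: "endo_trace D = real DIM('a)"
proof -
  have "endo_trace (\<lambda>x. D x - x) = 0"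
  proof (rule endo_trace_skew[OF metric])
    show "linear (\<lambda>x. D x - x)"
      by (intro linear_compose_sub D_linear linear_ident)
    show "g (D x - x) y + g x (D y - y) = 0" for x y
      using D_metric[of x y] by (simp add: g_rules)
  qed
  then show ?thesis by (simp add: endo_trace_diff endo_trace_id)
qed

text \<open>
  The derivation property at brackets of original vectors says that \<open>D\<close> dilates \<open>\<omega>\<close> by the same
  factor as \<open>g\<close>. As \<open>\<omega>\<close> is \<open>g\<close> twisted by \<open>J\<close>, this forces \<open>D\<close> to commute with \<open>J\<close>.
\<close>
lemma D_J: "D (J x) = J (D x)"
proof (rule g_eqI)
  fix y
  have "\<omega> (D y) x + \<omega> y (D x) = 2 * \<omega> y x"
  proof -
    have "central_action D (brk (y, 0) (x, 0))
        = brk (central_action D (y, 0)) (x, 0) + brk (y, 0) (central_action D (x, 0))"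
      using action_derivation by (simp add: derivation_def)
    then show ?thesis by (simp add: central_action_def central_extension_def)
  qed
  then show "g (D (J x)) y = g (J (D x)) y"
    using D_metric[of y "J x"] g_sym[of y] by (simp add: omega_eq)
qed

lemma omega_bilinear: "bilinear \<omega>"
proof -
  have "\<omega> = (\<lambda>x y. g x (J y))" by (intro ext omega_eq)
  then show ?thesis
    unfolding bilinear_def by (auto intro!: linearI simp: g_rules J_rules)
qed

lemma omega_anti: "\<omega> x y = - \<omega> y x"
  using g_J_skew[of y x] g_sym[of x] by (simp add: omega_eq)

lemma lie_algebra_brk: "lie_algebra brk"
proof (rule lie_algebra_central_extension[OF lie])
  show "bilinear (\<lambda>x y. 2 * \<omega> x y)"
    unfolding bilinear_def
    by (auto intro!: linearI simp: bilinear_rules[OF omega_bilinear] field_simps)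
  show "2 * \<omega> x x = 0" for x
    using omega_anti[of x x] by simp
  show "ext_deriv2 br (\<lambda>x y. 2 * \<omega> x y) x y z = 0" for x y z
    using omega_closed[of x y z] by (simp add: ext_deriv2_def omega_eq)
qed

lemma lie_algebra_brt: "lie_algebra brt"
  by (rule lie_algebra_semidirect[OF lie_algebra_brk action_derivation])

lemma brt_eq:
  "brt ((x, s), u) ((y, t), v)
    = ((br x y + u *\<^sub>R D y - v *\<^sub>R D x, - 2 * \<omega> x y + 2 * u * t - 2 * v * s), 0)"
  by (simp add: semidirect_def central_extension_def central_action_def)

lemma tilde_J_eq: "tilde_J g J ((x, s), u) = ((J x, - u), s)"
  by (simp add: tilde_J_def central_J_def central_metric_def central_b_def semidirect_e0_def
      g_rules)

lemma tilde_metric_eq: "tilde_metric g ((x, s), u) ((y, t), v) = g x y - s * t - u * v"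
  by (simp add: tilde_metric_def central_metric_def)

text \<open>
  This is \<open>\<omega> = d b\<^sup>* / 2\<close> on the extension: the signs of \<open>g\<close> along \<open>b\<close> and \<open>e\<^sub>0\<close> and the eigenvalue
  2 of \<open>e\<^sub>0\<close> on \<open>b\<close> are chosen to make it hold. Closedness then is the Jacobi identity.
\<close>
lemma tilde_omega_exact: "tilde_omega g J X Y = - snd (fst (brt X Y)) / 2"
proof -
  obtain x s u y t v where XY: "X = ((x, s), u)" "Y = ((y, t), v)"
    by (metis prod.exhaust)
  show ?thesis
    unfolding XY
    by (simp add: tilde_omega_def tilde_J_eq tilde_metric_eq brt_eq) (simp add: omega_eq field_simps)
qed

lemma metric_form_tilde: "metric_form (tilde_metric g)"
proof -
  have "bilinear (tilde_metric g)"
    unfolding bilinear_def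
    by (auto intro!: linearI simp: tilde_metric_def central_metric_def g_rules algebra_simps)
  moreover have "tilde_metric g X Y = tilde_metric g Y X" for X Y
    by (simp add: tilde_metric_def central_metric_def g_sym mult.commute)
  moreover have "X = 0" if "\<forall>Y. tilde_metric g X Y = 0" for X
  proof -
    obtain x s u where X: "X = ((x, s), u)"
      by (metis prod.exhaust)
    have *: "g x y - s * t - u * v = 0" for y t v
      using that by (metis X tilde_metric_eq)
    have "x = 0"
      using *[of _ 0 0] by (intro g_eqI) (simp add: g_rules)
    moreover have "s = 0" "u = 0"
      using *[of 0 1 0] *[of 0 0 1] by (simp_all add: g_rules)
    ultimately show ?thesis by (simp add: X zero_prod_def)
  qed
  ultimately show ?thesis
    unfolding metric_form_def by blast
qed

lemma pseudo_kaehler_tilde: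
  "pseudo_kaehler brt (tilde_metric g) (tilde_J g J) (tilde_omega g J)"
  unfolding pseudo_kaehler_def
proof (intro conjI allI)
  show "metric_form (tilde_metric g)" by (rule metric_form_tilde)
  show "linear (tilde_J g J)"
    by (rule linearI) (auto simp: tilde_J_eq J_rules)
  show "tilde_J g J (tilde_J g J X) = - X" for X
    by (cases X rule: prod.exhaust, cases "fst X") (auto simp: tilde_J_eq)
  show "tilde_omega g J X Y = tilde_metric g X (tilde_J g J Y)" for X Y
    by (simp add: tilde_omega_def)
  show "tilde_metric g (tilde_J g J X) (tilde_J g J Y) = tilde_metric g X Y" for X Y
  proof -
    obtain x s u y t v where XY: "X = ((x, s), u)" "Y = ((y, t), v)"
      by (metis prod.exhaust)
    show ?thesis unfolding XY by (simp add: tilde_J_eq tilde_metric_eq g_J_J)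
  qed
  show "nijenhuis brt (tilde_J g J) X Y = 0" for X Y
  proof -
    obtain x s u y t v where XY: "X = ((x, s), u)" "Y = ((y, t), v)"
      by (metis prod.exhaust)
    have "br (J x) (J y) = J (br (J x) y) + J (br x (J y)) + br x y"
      using nijenhuis_zero[of x y] by (simp add: algebra_simps)
    then show ?thesis
      unfolding XY nijenhuis_def
      by (simp add: tilde_J_eq brt_eq D_J J_rules zero_prod_def scaleR_add_right)
        (simp add: omega_eq g_J_skew g_rules algebra_simps)
  qed
  show "ext_deriv2 brt (tilde_omega g J) X Y Z = 0" for X Y Z
  proof -
    interpret T: metric_lie_algebra brt "tilde_metric g"
      by unfold_locales (rule lie_algebra_brt metric_form_tilde)+
    have "brt (brt X Y) Z - brt (brt X Z) Y + brt (brt Y Z) X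
        = - (brt X (brt Y Z) + brt Y (brt Z X) + brt Z (brt X Y))"
      using T.br_anti[of "brt X Y" Z] T.br_anti[of "brt X Z" Y] T.br_anti[of "brt Y Z" X]
        T.br_anti[of Z X] by (simp add: T.br_rules)
    also have "\<dots> = 0" by (simp only: T.jacobi minus_zero)
    finally have "snd (fst (brt (brt X Y) Z - brt (brt X Z) Y + brt (brt Y Z) X)) = 0"
      by simp
    then show ?thesis
      by (simp add: ext_deriv2_def tilde_omega_exact)
  qed
qed

text \<open>
  A commutator has the form \<open>z + t b\<close>. Its contribution to the Ricci form comes from \<open>t\<close> alone,
  through the pair \<open>b, e\<^sub>0\<close> that the complex structure interchanges.
\<close>
lemma ricci_tilde:
  "ricci brt (tilde_metric g) X Y = (real DIM(('a \<times> real) \<times> real) + 2) * tilde_metric g X Y"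
proof -
  interpret T: pseudo_kaehler_lie_algebra brt "tilde_metric g" "tilde_J g J" "tilde_omega g J"
    by unfold_locales (rule lie_algebra_brt metric_form_tilde pseudo_kaehler_tilde)+
  define Z where "Z = - tilde_J g J Y"
  have Y: "tilde_J g J Z = Y"
    by (simp add: Z_def T.J_rules)
  obtain z t where B: "brt X Z = ((z, t), 0)"
    by (metis prod.exhaust semidirect_def)
  have 1: "endo_trace (\<lambda>W. tilde_J g J (brt ((z, t), 0) W)) = - 2 * t"
    by (simp add: endo_trace_prod endo_trace_real zero_prod_def brt_eq tilde_J_eq D_rules br_rules
        bilinear_rules[OF omega_bilinear]
        endo_trace_complex_ad_nilpotent[OF br_bilinear nil J_linear J_J] nijenhuis_def
        nijenhuis_zero)
  have 2: "endo_trace (brt (tilde_J g J ((z, t), 0))) = (real DIM('a) + 2) * t"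
  proof -
    have "endo_trace (\<lambda>x. br (J z) x + t *\<^sub>R D x) = real DIM('a) * t"
      by (simp add: endo_trace_add endo_trace_scaleR endo_trace_D
          endo_trace_ad_nilpotent[OF br_bilinear nil])
    then show ?thesis
      by (simp add: endo_trace_prod endo_trace_real zero_prod_def brt_eq tilde_J_eq D_rules br_rules
        bilinear_rules[OF omega_bilinear] algebra_simps)
  qed
  have "2 * ricci brt (tilde_metric g) X Y = - (real DIM('a) + 4) * t"
    using T.ricci_J_eq[of X Z] by (simp add: Y B 1 2 algebra_simps)
  moreover have "t = - 2 * tilde_metric g X Y"
    using tilde_omega_exact[of X Z] by (simp add: B tilde_omega_def Y)
  ultimately show ?thesis by (simp add: algebra_simps)
qed

end

theorem corollary3p6:
  fixes br :: "'a::euclidean_space \<Rightarrow> 'a \<Rightarrow> 'a"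
    and g \<omega> :: "'a \<Rightarrow> 'a \<Rightarrow> real"
    and J N D :: "'a \<Rightarrow> 'a"
  defines "brk \<equiv> central_extension br (\<lambda>x y. 2 * \<omega> x y)"
  defines "brt \<equiv> semidirect brk (central_action D)"
  assumes "lie_algebra br"
    and "nilpotent_lie br"
    and "pseudo_kaehler br g J \<omega>"
    and "metric_nikolayevsky br g N"
    and "N \<noteq> (\<lambda>x. 0)"
    and "derivation br D"
    and "sym_part g D = id"
    and semidirect_product_defined: "derivation brk (central_action D)"
  shows "lie_algebra brk \<and> lie_algebra brt \<and>
    pseudo_kaehler_einstein brt (tilde_metric g) (tilde_J g J) (tilde_omega g J) \<and>
    (\<forall>X Y. ricci brt (tilde_metric g) X Y
       = (real DIM(('a \<times> real) \<times> real) + 2) * tilde_metric g X Y)"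
proof -
  interpret kaehler_homothety br g J \<omega> D
    using assms by unfold_locales (auto simp: pseudo_kaehler_def)
  show ?thesis
    unfolding brt_def brk_def pseudo_kaehler_einstein_def einstein_def
    using lie_algebra_brk lie_algebra_brt pseudo_kaehler_tilde ricci_tilde by blast
qed

end
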